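(* Let $(E,\mathcal E,\mu)$ be a measure space and let $G\colon E\times E\to[0,\infty]$ be $\mathcal E\otimes\mathcal E$-measurable. If there is a strictly positive function in $\mathcal F_{ui}(G)$, then $\mathcal F_{co}(G)\subset\mathcal F_{ui}(G)$.
   Context: $\mathcal E^+$ is the set of all $\mathcal E$-measurable functions $f\colon E\to[0,\infty]$. $\mathcal E_b$ is the space of all bounded $\mathcal E$-measurable functions $f\colon E\to\mathbb R$, equipped with the sup-norm $\|\cdot\|_\infty$. The convention $0\cdot\infty=0$ is used. A function $q$ on $E$ is strictly positive if $q(x)>0$ for every $x\in E$. For a measurable function $f$ on $E$ (for $f\in\mathcal E^+$, or whenever the integrals exist), $Gf(x):=\int G(x,y)f(y)\,d\mu(y)$, $x\in E$. For $q\in\mathcal E^+$ with $Gq$ bounded, $K_q$ denotes the map $f\mapsto G(fq)$ on $\mathcal E_b$, i.e. $K_qf(x)=\int G(x,y)f(y)q(y)\,d\mu(y)$. $\mathcal F_{co}(G)$ is the set of all $q\in\mathcal E^+$ such that $Gq$ is bounded and $K_q$ is a compact operator on $\mathcal E_b$ (in particular it maps $\mathcal E_b$ into $\mathcal E_b$). A subset $\mathcal F$ of $\mathcal E^+$ is called uniformly integrable if for every $\varepsilon>0$ there exists a $\mu$-integrable $g\in\mathcal E^+$ such that $\int_{\{f\ge g\}}f\,d\mu\le\varepsilon$ for every $f\in\mathcal F$. $\mathcal F_{ui}(G)$ is the set of all $q\in\mathcal E^+$ such that the family $\{G(x,\cdot)q\colon x\in E\}$ is uniformly integrable. *)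

theory Defs
  imports "HOL-Analysis.Analysis"
begin

text \<open>
  The measure space is \<open>M\<close>, with \<open>E = space M\<close>. The set of \<open>[0,\<infinity>]\<close>-valued measurable functions
  is \<open>borel_measurable M :: ('a \<Rightarrow> ennreal) set\<close>; values of such functions (and of the kernel \<open>G\<close>)
  outside \<open>space M\<close> are irrelevant. In \<^typ>\<open>ennreal\<close> we have \<open>0 * \<infinity> = 0\<close>.
\<close>

definition pot :: "'a measure \<Rightarrow> ('a \<Rightarrow> 'a \<Rightarrow> ennreal) \<Rightarrow> ('a \<Rightarrow> ennreal) \<Rightarrow> 'a \<Rightarrow> ennreal" where
  "pot M G f x = (\<integral>\<^sup>+ y. G x y * f y \<partial>M)"

definition pot_bounded :: "'a measure \<Rightarrow> ('a \<Rightarrow> 'a \<Rightarrow> ennreal) \<Rightarrow> ('a \<Rightarrow> ennreal) \<Rightarrow> bool" where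
  "pot_bounded M G q \<longleftrightarrow> (\<exists>C::real. \<forall>x\<in>space M. pot M G q x \<le> ennreal C)"

text \<open>
  Bounded measurable real functions on \<open>space M\<close> with the sup-norm distance. The functions
  are normalised to be \<^const>\<open>extensional\<close>, so that equality is equality on \<open>space M\<close>;
  \<^const>\<open>funspace\<close> is the library's space of bounded functions with the supremum metric.
\<close>

definition bdd_meas :: "'a measure \<Rightarrow> ('a \<Rightarrow> real) metric" where
  "bdd_meas M = submetric (funspace (space M) euclidean_metric) (borel_measurable M)"

definition compact_op :: "'a measure \<Rightarrow> (('a \<Rightarrow> real) \<Rightarrow> ('a \<Rightarrow> real)) \<Rightarrow> bool" where
  "compact_op M K \<longleftrightarrow>
     K \<in> mspace (bdd_meas M) \<rightarrow> mspace (bdd_meas M) \<and>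
     (\<forall>f\<in>mspace (bdd_meas M). \<forall>g\<in>mspace (bdd_meas M). \<forall>a b.
        K (\<lambda>x\<in>space M. a * f x + b * g x) = (\<lambda>x\<in>space M. a * K f x + b * K g x)) \<and>
     compactin (mtopology_of (bdd_meas M))
       (mtopology_of (bdd_meas M) closure_of
          (K ` mcball_of (bdd_meas M) (\<lambda>x\<in>space M. 0) 1))"

text \<open>
  \<open>K\<^sub>q f = G(f q)\<close> for real \<open>f\<close>. The integrand \<open>G(x,y) f(y) q(y)\<close> is extended-real-valued, and its
  integral is by definition the difference of the integrals of its positive and negative parts;
  here \<open>ennreal (f y)\<close> and \<open>ennreal (- f y)\<close> are the positive and negative parts of \<open>f y\<close>.
  When \<open>Gq\<close> and \<open>f\<close> are bounded, both integrals are finite.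
\<close>

definition Kop ::
  "'a measure \<Rightarrow> ('a \<Rightarrow> 'a \<Rightarrow> ennreal) \<Rightarrow> ('a \<Rightarrow> ennreal) \<Rightarrow> ('a \<Rightarrow> real) \<Rightarrow> 'a \<Rightarrow> real" where
  "Kop M G q f =
     (\<lambda>x\<in>space M. enn2real (pot M G (\<lambda>y. ennreal (f y) * q y) x)
                 - enn2real (pot M G (\<lambda>y. ennreal (- f y) * q y) x))"

definition F_co :: "'a measure \<Rightarrow> ('a \<Rightarrow> 'a \<Rightarrow> ennreal) \<Rightarrow> ('a \<Rightarrow> ennreal) set" where
  "F_co M G = {q \<in> borel_measurable M. pot_bounded M G q \<and> compact_op M (Kop M G q)}"

definition unif_integrable :: "'a measure \<Rightarrow> ('a \<Rightarrow> ennreal) set \<Rightarrow> bool" where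
  "unif_integrable M F \<longleftrightarrow>
     F \<subseteq> borel_measurable M \<and>
     (\<forall>\<epsilon>::real. \<epsilon> > 0 \<longrightarrow>
        (\<exists>g\<in>borel_measurable M. (\<integral>\<^sup>+ y. g y \<partial>M) < \<infinity> \<and>
           (\<forall>f\<in>F. (\<integral>\<^sup>+ y\<in>{y \<in> space M. f y \<ge> g y}. f y \<partial>M) \<le> ennreal \<epsilon>)))"

definition F_ui :: "'a measure \<Rightarrow> ('a \<Rightarrow> 'a \<Rightarrow> ennreal) \<Rightarrow> ('a \<Rightarrow> ennreal) set" where
  "F_ui M G = {q \<in> borel_measurable M. unif_integrable M ((\<lambda>x y. G x y * q y) ` space M)}"

end

theory Submission
  imports Defs
begin

text \<open>
  Let \<open>q\<^sub>0 > 0\<close> be in \<open>F_ui M G\<close>, let \<open>q \<in> F_co M G\<close> and \<open>A n = {q > n q\<^sub>0}\<close>. Since \<open>Gq\<close> is bounded,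
  \<open>G(x, \<cdot>)\<close> vanishes almost everywhere on \<open>{q = \<infinity>}\<close>, so dominated convergence shows that
  \<open>K\<^sub>q 1\<^bsub>A n\<^esub> = G(1\<^bsub>A n\<^esub> q)\<close> tends to \<open>0\<close> pointwise. Compactness of \<open>K\<^sub>q\<close> makes \<open>G(1\<^bsub>A n\<^esub> q)\<close> uniformly
  small for some \<open>n\<close>. Off \<open>A n\<close>, the family \<open>G(x, \<cdot>) q\<close> is dominated by \<open>n G(x, \<cdot>) q\<^sub>0\<close>, which is
  uniformly integrable.
\<close>

lemma mspace_bdd_meas:
  "mspace (bdd_meas M) = {f \<in> borel_measurable M. f \<in> extensional (space M) \<and> bounded (f ` space M)}"
  unfolding bdd_meas_def by (auto simp: Met_TC.fspace_def)

lemma mdist_bdd_meas_le: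
  assumes "f \<in> mspace (bdd_meas M)" "g \<in> mspace (bdd_meas M)" "space M \<noteq> {}"
  shows "mdist (bdd_meas M) f g \<le> a \<longleftrightarrow> (\<forall>x\<in>space M. dist (f x) (g x) \<le> a)"
  using assms funspace_mdist_le[of f "space M" euclidean_metric g a] by (simp add: bdd_meas_def)

text \<open>Supplies the test functions to which compactness of the operator is applied.\<close>

lemma indicator_in_unit_ball_bdd_meas:
  assumes "A \<in> sets M" "space M \<noteq> {}"
  shows "(\<lambda>x\<in>space M. indicator A x) \<in> mcball_of (bdd_meas M) (\<lambda>x\<in>space M. 0) 1"
proof -
  have "restrict f (space M) \<in> borel_measurable M \<longleftrightarrow> f \<in> borel_measurable M" for f :: "_ \<Rightarrow> real"
    by (rule measurable_cong) simp
  moreover have "bounded ((\<lambda>x\<in>space M. indicator A x :: real) ` space M)"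
    by (rule boundedI[of _ 1]) (auto simp: indicator_def)
  moreover have "bounded ((\<lambda>x\<in>space M. 0 :: real) ` space M)"
    by (rule boundedI[of _ 1]) auto
  ultimately have "(\<lambda>x\<in>space M. indicator A x) \<in> mspace (bdd_meas M)"
    "(\<lambda>x\<in>space M. 0) \<in> mspace (bdd_meas M)"
    using assms(1) by (auto simp: mspace_bdd_meas)
  then show ?thesis
    using assms(2) by (auto simp: mdist_bdd_meas_le indicator_def)
qed

text \<open>By compactness, some subsequence of \<open>K (f n)\<close> converges in sup-norm.
  Uniform convergence implies pointwise convergence, so the limit can only be 0, and the members of
  the subsequence become uniformly small. The bound \<open>m\<close> lets a caller exclude small
  indices.\<close>

lemma compact_op_pointwise_null_imp_uniform:
  assumes K: "compact_op M K" and ne: "space M \<noteq> {}"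
    and f: "\<And>n::nat. f n \<in> mcball_of (bdd_meas M) (\<lambda>x\<in>space M. 0) 1"
    and lim: "\<And>x. x \<in> space M \<Longrightarrow> (\<lambda>n. K (f n) x) \<longlonglongrightarrow> 0"
    and "\<epsilon> > 0"
  shows "\<exists>n\<ge>m. \<forall>x\<in>space M. \<bar>K (f n) x\<bar> \<le> \<epsilon>"
proof -
  interpret Metric_space "mspace (bdd_meas M)" "mdist (bdd_meas M)"
    by (rule Metric_space_mspace_mdist)
  define S where "S = mtopology closure_of (K ` mcball_of (bdd_meas M) (\<lambda>x\<in>space M. 0) 1)"
  have "compactin mtopology S" and maps: "K \<in> mspace (bdd_meas M) \<rightarrow> mspace (bdd_meas M)"
    using K by (auto simp: compact_op_def S_def mtopology_of_def)
  moreover have "K ` mcball_of (bdd_meas M) (\<lambda>x\<in>space M. 0) 1 \<subseteq> topspace mtopology"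
    using maps by auto
  then have "range (\<lambda>n. K (f n)) \<subseteq> S"
    unfolding S_def using f closure_of_subset by fast
  ultimately obtain l r where "strict_mono r"
    and l: "limitin mtopology ((\<lambda>n. K (f n)) \<circ> r) l sequentially"
    unfolding compactin_sequentially by blast
  have lsp: "l \<in> mspace (bdd_meas M)"
    using l limitin_mspace by blast
  have Ksp: "K (f n) \<in> mspace (bdd_meas M)" for n
    using maps f[of n] by auto
  have close: "\<forall>\<^sub>F n in sequentially. \<forall>x\<in>space M. dist (K (f (r n)) x) (l x) \<le> e" if "e > 0" for e
  proof -
    have "\<forall>\<^sub>F n in sequentially. mdist (bdd_meas M) (K (f (r n))) l < e"
      using l that by (auto simp: limitin_metric elim: eventually_mono)
    then show ?thesis
      by eventually_elim (simp flip: mdist_bdd_meas_le[OF Ksp lsp ne])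
  qed
  have l0: "l x = 0" if "x \<in> space M" for x
  proof (rule LIMSEQ_unique)
    show "(\<lambda>n. K (f (r n)) x) \<longlonglongrightarrow> 0"
      using LIMSEQ_subseq_LIMSEQ[OF lim[OF that] \<open>strict_mono r\<close>] by (simp add: o_def)
    show "(\<lambda>n. K (f (r n)) x) \<longlonglongrightarrow> l x"
    proof (rule tendstoI)
      fix e :: real assume "e > 0"
      \<comment> \<open>The distance in \<open>close\<close> is bounded non-strictly, whereas
        \<open>tendstoI\<close> asks for a strict bound; hence \<open>e / 2\<close>.\<close>
      then have "\<forall>\<^sub>F n in sequentially. \<forall>x\<in>space M. dist (K (f (r n)) x) (l x) \<le> e / 2"
        by (intro close) simp
      then show "\<forall>\<^sub>F n in sequentially. dist (K (f (r n)) x) (l x) < e"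
      proof eventually_elim
        case (elim n)
        then have "dist (K (f (r n)) x) (l x) \<le> e / 2" using that by blast
        then show ?case using \<open>e > 0\<close> by linarith
      qed
    qed
  qed
  have "\<forall>\<^sub>F n in sequentially. r n \<ge> m"
    using filterlim_subseq[OF \<open>strict_mono r\<close>] by (simp add: filterlim_at_top)
  with close[OF \<open>\<epsilon> > 0\<close>]
  have "\<forall>\<^sub>F n in sequentially. r n \<ge> m \<and> (\<forall>x\<in>space M. \<bar>K (f (r n)) x\<bar> \<le> \<epsilon>)"
    by eventually_elim (use l0 in auto)
  then show ?thesis
    using eventually_happens' sequentially_bot by blast
qed

lemma Kop_indicator:
  assumes "x \<in> space M"
  shows "Kop M G q (\<lambda>x\<in>space M. indicator A x) x = enn2real (pot M G (\<lambda>y. indicator A y * q y) x)"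
proof -
  have "pot M G (\<lambda>y. ennreal ((\<lambda>x\<in>space M. indicator A x) y) * q y) x =
      pot M G (\<lambda>y. indicator A y * q y) x"
    unfolding pot_def by (rule nn_integral_cong) (auto simp: indicator_def)
  \<comment> \<open>\<open>ennreal\<close> maps negative reals to 0, so the negative part of an
    indicator contributes nothing.\<close>
  moreover have "pot M G (\<lambda>y. ennreal (- (\<lambda>x\<in>space M. indicator A x) y) * q y) x = (\<integral>\<^sup>+ y. 0 \<partial>M)"
    unfolding pot_def by (rule nn_integral_cong) (auto simp: indicator_def ennreal_neg)
  ultimately show ?thesis
    using assms by (simp add: Kop_def)
qed

text \<open>Dominated convergence with majorant \<open>G x y * q y\<close>. For almost every
  \<open>y\<close> the integrand is eventually 0: either \<open>G x y = 0\<close>, or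
  \<open>q y\<close> is finite and, since \<open>p y > 0\<close>, is at most
  \<open>of_nat n * p y\<close> for all large \<open>n\<close>.\<close>

lemma pot_indicator_superlevel_tendsto_0:
  assumes [measurable]: "G x \<in> borel_measurable M" "q \<in> borel_measurable M" "p \<in> borel_measurable M"
    and pos: "\<And>y. y \<in> space M \<Longrightarrow> p y > 0"
    and fin: "pot M G q x < \<infinity>"
  shows "(\<lambda>n. pot M G (\<lambda>y. indicator {y \<in> space M. q y > of_nat n * p y} y * q y) x) \<longlonglongrightarrow> 0"
proof -
  define u where "u n y = G x y * (indicator {y \<in> space M. q y > of_nat n * p y} y * q y)" for n y
  have "(\<lambda>n. \<integral>\<^sup>+ y. u n y \<partial>M) \<longlonglongrightarrow> (\<integral>\<^sup>+ y. 0 \<partial>M)"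
  proof (rule nn_integral_dominated_convergence)
    show "u n \<in> borel_measurable M" for n
      unfolding u_def by measurable
    show "(\<lambda>y. G x y * q y) \<in> borel_measurable M"
      by measurable
    show "AE y in M. u n y \<le> G x y * q y" for n
      by (auto simp: u_def indicator_def)
    show "(\<integral>\<^sup>+ y. G x y * q y \<partial>M) < \<infinity>"
      using fin by (simp add: pot_def)
    have "AE y in M. G x y * q y \<noteq> \<infinity>"
      by (rule nn_integral_PInf_AE) (use fin in \<open>auto simp: pot_def\<close>)
    then show "AE y in M. (\<lambda>n. u n y) \<longlonglongrightarrow> 0"
    proof (eventually_elim, goal_cases)
      case (1 y)
      show ?case
      proof (cases "y \<in> space M \<and> G x y \<noteq> 0")
        case True
        then have "q y < \<infinity>" "p y > 0"
          using 1 pos by (auto simp: ennreal_mult_eq_top_iff less_top)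
        obtain N where N: "q y \<le> of_nat N * p y"
        \<comment> \<open>The choice of \<open>N\<close> above the quotient \<open>q y / p y\<close>
          fails for infinite \<open>p y\<close>: there the quotient is 0, and multiplying it back by
          \<open>p y\<close> gives 0 instead of \<open>q y\<close>.\<close>
        proof (cases "p y = \<infinity>")
          case True
          then show ?thesis using that[of 1] by simp
        next
          case False
          then have "q y / p y \<noteq> \<infinity>"
            using \<open>q y < \<infinity>\<close> \<open>p y > 0\<close> by (auto simp: ennreal_divide_eq_top_iff)
          then obtain N where "q y / p y < of_nat N"
            using ennreal_Ex_less_of_nat[of "q y / p y"] by (auto simp: less_top)
          then have "q y / p y * p y \<le> of_nat N * p y"
            by (intro mult_right_mono) auto
          moreover have "q y / p y * p y = q y"
            using False \<open>p y > 0\<close> ennreal_divide_self[of "p y"]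
            by (auto simp: ennreal_divide_times less_top)
          ultimately show ?thesis using that by simp
        qed
        have "u n y = 0" if "n \<ge> N" for n
        proof -
          have "of_nat N * p y \<le> of_nat n * p y"
            using that by (intro mult_right_mono) auto
          then show ?thesis using N by (auto simp: u_def indicator_def)
        qed
        then show ?thesis
          by (intro tendsto_eventually) (auto simp: eventually_sequentially)
      next
        case False
        then have "u n y = 0" for n
          by (auto simp: u_def)
        then show ?thesis by simp
      qed
    qed
  qed simp
  then show ?thesis
    by (simp add: pot_def u_def)
qed

text \<open>At a point off \<open>A\<close> with \<open>f y \<ge> c * g y\<close>, domination gives
  \<open>c * g y \<le> c * h y\<close>. Cancelling \<open>c\<close>, which is positive and finite,
  puts the point in the superlevel set of \<open>h\<close> over \<open>g\<close>, where
  \<open>c * h\<close> bounds \<open>f\<close>. The set \<open>A\<close> is paid for by the first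
  summand.\<close>

lemma nn_integral_superlevel_le:
  fixes c :: ennreal
  assumes [measurable]: "f \<in> borel_measurable M" "h \<in> borel_measurable M" "g \<in> borel_measurable M"
      "A \<in> sets M"
    and c: "0 < c" "c < \<infinity>"
    and dom: "\<And>y. y \<in> space M - A \<Longrightarrow> f y \<le> c * h y"
  shows "(\<integral>\<^sup>+ y\<in>{y \<in> space M. f y \<ge> c * g y}. f y \<partial>M)
    \<le> (\<integral>\<^sup>+ y\<in>A. f y \<partial>M) + c * (\<integral>\<^sup>+ y\<in>{y \<in> space M. h y \<ge> g y}. h y \<partial>M)"
proof -
  have "(\<integral>\<^sup>+ y\<in>{y \<in> space M. f y \<ge> c * g y}. f y \<partial>M)
    \<le> (\<integral>\<^sup>+ y. f y * indicator A y + c * (h y * indicator {y \<in> space M. h y \<ge> g y} y) \<partial>M)"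
  proof (rule nn_integral_mono)
    fix y assume y: "y \<in> space M"
    show "f y * indicator {y \<in> space M. f y \<ge> c * g y} y
      \<le> f y * indicator A y + c * (h y * indicator {y \<in> space M. h y \<ge> g y} y)"
    proof (cases "y \<notin> A \<and> f y \<ge> c * g y")
      case True
      then have "f y \<le> c * h y" using dom y by auto
      with True have "c * g y \<le> c * h y" by (meson order_trans)
      then have "g y \<le> h y"
        using c by (simp add: ennreal_mult_le_mult_iff less_top)
      with \<open>f y \<le> c * h y\<close> True y show ?thesis by (simp add: indicator_def)
    qed (use y in \<open>auto simp: indicator_def\<close>)
  qed
  also have "\<dots> = (\<integral>\<^sup>+ y\<in>A. f y \<partial>M) + c * (\<integral>\<^sup>+ y\<in>{y \<in> space M. h y \<ge> g y}. h y \<partial>M)"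
    by (simp add: nn_integral_add nn_integral_cmult)
  finally show ?thesis .
qed

theorem theorem2p2:
  fixes M :: "'a measure" and G :: "'a \<Rightarrow> 'a \<Rightarrow> ennreal"
  assumes "(\<lambda>(x, y). G x y) \<in> borel_measurable (M \<Otimes>\<^sub>M M)"
    and "\<exists>q\<in>F_ui M G. \<forall>x\<in>space M. q x > 0"
  shows "F_co M G \<subseteq> F_ui M G"
proof
  fix q assume "q \<in> F_co M G"
  then have q[measurable]: "q \<in> borel_measurable M" and bdd: "pot_bounded M G q"
    and cpt: "compact_op M (Kop M G q)"
    by (auto simp: F_co_def)
  obtain p where p: "p \<in> F_ui M G" and pos: "\<And>y. y \<in> space M \<Longrightarrow> p y > 0"
    using assms(2) by blast
  then have p_meas[measurable]: "p \<in> borel_measurable M"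
    by (simp add: F_ui_def)
  have G[measurable]: "G x \<in> borel_measurable M" if "x \<in> space M" for x
    using measurable_Pair2[OF assms(1) that] by simp
  have fin: "pot M G q x < \<infinity>" if "x \<in> space M" for x
    using bdd that unfolding pot_bounded_def by (metis ennreal_less_top infinity_ennreal_def order_le_less_trans)
  define A where "A n = {y \<in> space M. q y > of_nat n * p y}" for n :: nat
  have A[measurable]: "A n \<in> sets M" for n
    unfolding A_def by measurable
  define v where "v n x = pot M G (\<lambda>y. indicator (A n) y * q y) x" for n x
  have v_fin: "v n x < \<infinity>" if "x \<in> space M" for n x
  proof -
    have "v n x \<le> pot M G q x"
      unfolding v_def pot_def by (intro nn_integral_mono) (auto simp: indicator_def)
    then show ?thesis using fin[OF that] by (rule order_le_less_trans)
  qed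
  have "\<exists>g\<in>borel_measurable M. (\<integral>\<^sup>+ y. g y \<partial>M) < \<infinity> \<and>
      (\<forall>f\<in>(\<lambda>x y. G x y * q y) ` space M. (\<integral>\<^sup>+ y\<in>{y \<in> space M. f y \<ge> g y}. f y \<partial>M) \<le> ennreal \<epsilon>)"
    if "\<epsilon> > 0" for \<epsilon> :: real
  \<comment> \<open>On an empty space the family is empty and any integrable \<open>g\<close> will
    do; the pointwise description of the sup-norm distance is available only on a nonempty
    space.\<close>
  proof (cases "space M = {}")
    case True
    then show ?thesis by (intro bexI[of _ "\<lambda>_. 0"]) auto
  next
    case ne: False
    have lim: "(\<lambda>n. Kop M G q (\<lambda>x\<in>space M. indicator (A n) x) x) \<longlonglongrightarrow> 0" if "x \<in> space M" for x
    proof -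
      have "(\<lambda>n. v n x) \<longlonglongrightarrow> ennreal 0"
        using pot_indicator_superlevel_tendsto_0[OF G[OF that] q p_meas pos fin[OF that]]
        unfolding v_def A_def by simp
      then have "(\<lambda>n. enn2real (v n x)) \<longlonglongrightarrow> 0"
        by (rule tendsto_enn2real) simp
      then show ?thesis
        using that by (simp add: Kop_indicator v_def)
    qed
    \<comment> \<open>Half of \<open>\<epsilon>\<close> is spent on \<open>A n\<close>. Asking for
      \<open>n \<ge> 1\<close> permits division by \<open>n\<close> and cancellation of the factor
      \<open>of_nat n\<close> below.\<close>
    have "\<exists>n\<ge>1. \<forall>x\<in>space M. \<bar>Kop M G q (\<lambda>x\<in>space M. indicator (A n) x) x\<bar> \<le> \<epsilon> / 2"
    proof (rule compact_op_pointwise_null_imp_uniform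
        [OF cpt ne, where f = "\<lambda>n. \<lambda>x\<in>space M. indicator (A n) x"])
      show "(\<lambda>x\<in>space M. indicator (A n) x) \<in> mcball_of (bdd_meas M) (\<lambda>x\<in>space M. 0) 1" for n
        by (rule indicator_in_unit_ball_bdd_meas[OF A ne])
      show "\<epsilon> / 2 > 0" using that by simp
    qed (rule lim)
    then obtain n where "n \<ge> 1"
      and n: "\<And>x. x \<in> space M \<Longrightarrow> \<bar>Kop M G q (\<lambda>x\<in>space M. indicator (A n) x) x\<bar> \<le> \<epsilon> / 2"
      by blast
    \<comment> \<open>\<open>enn2real\<close> sends infinity to 0, so a bound on \<open>Kop\<close>
      bounds \<open>v n x\<close> only because \<open>v n x\<close> is known to be finite.\<close>
    have v_le: "v n x \<le> ennreal (\<epsilon> / 2)" if "x \<in> space M" for x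
    proof -
      have "v n x = ennreal (enn2real (v n x))"
        using v_fin[OF that, of n] by simp
      also have "\<dots> \<le> ennreal (\<epsilon> / 2)"
        using n[OF that] that by (intro ennreal_leI) (simp add: Kop_indicator v_def)
      finally show ?thesis .
    qed
    \<comment> \<open>Off \<open>A n\<close> the tail for \<open>p\<close> gets multiplied by
      \<open>n\<close>, so the tolerance \<open>\<epsilon> / (2 * n)\<close> turns into the other
      half of \<open>\<epsilon>\<close>.\<close>
    have "\<exists>g\<in>borel_measurable M. (\<integral>\<^sup>+ y. g y \<partial>M) < \<infinity> \<and>
        (\<forall>f\<in>(\<lambda>x y. G x y * p y) ` space M.
          (\<integral>\<^sup>+ y\<in>{y \<in> space M. f y \<ge> g y}. f y \<partial>M) \<le> ennreal (\<epsilon> / (2 * n)))"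
    proof -
      have "unif_integrable M ((\<lambda>x y. G x y * p y) ` space M)"
        using p by (simp add: F_ui_def)
      then show ?thesis
        unfolding unif_integrable_def by (elim conjE allE impE) (use that \<open>n \<ge> 1\<close> in simp_all)
    qed
    then obtain g where [measurable]: "g \<in> borel_measurable M" and g_fin: "(\<integral>\<^sup>+ y. g y \<partial>M) < \<infinity>"
      and g: "\<forall>f\<in>(\<lambda>x y. G x y * p y) ` space M.
        (\<integral>\<^sup>+ y\<in>{y \<in> space M. f y \<ge> g y}. f y \<partial>M) \<le> ennreal (\<epsilon> / (2 * n))"
      by (elim bexE conjE)
    show ?thesis
    proof (intro bexI conjI ballI)
      \<comment> \<open>The threshold for \<open>q\<close> is the one for \<open>p\<close> scaled by
        the same \<open>n\<close> that bounds \<open>q\<close> by a multiple of \<open>p\<close> off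
        \<open>A n\<close>.\<close>
      show "(\<lambda>y. of_nat n * g y) \<in> borel_measurable M" by measurable
      show "(\<integral>\<^sup>+ y. of_nat n * g y \<partial>M) < \<infinity>"
        using g_fin by (simp add: nn_integral_cmult ennreal_mult_less_top of_nat_less_top)
      fix f assume "f \<in> (\<lambda>x y. G x y * q y) ` space M"
      then obtain x where x[measurable]: "x \<in> space M" and f: "f = (\<lambda>y. G x y * q y)"
        by blast
      have "(\<integral>\<^sup>+ y\<in>{y \<in> space M. f y \<ge> of_nat n * g y}. f y \<partial>M) \<le>
        (\<integral>\<^sup>+ y\<in>A n. f y \<partial>M) + of_nat n * (\<integral>\<^sup>+ y\<in>{y \<in> space M. G x y * p y \<ge> g y}. (G x y * p y) \<partial>M)"
      proof (rule nn_integral_superlevel_le)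
        show "f \<in> borel_measurable M" unfolding f by measurable
        show "(0 :: ennreal) < of_nat n" using \<open>n \<ge> 1\<close> by simp
        fix y assume "y \<in> space M - A n"
        then have "q y \<le> of_nat n * p y" by (auto simp: A_def)
        then have "G x y * q y \<le> G x y * (of_nat n * p y)" by (intro mult_left_mono) auto
        then show "f y \<le> of_nat n * (G x y * p y)" by (simp add: f mult_ac)
      qed (simp_all add: of_nat_less_top)
      also have "(\<integral>\<^sup>+ y\<in>A n. f y \<partial>M) = v n x"
        by (simp add: f v_def pot_def mult_ac)
      also have "v n x + of_nat n * (\<integral>\<^sup>+ y\<in>{y \<in> space M. G x y * p y \<ge> g y}. (G x y * p y) \<partial>M)
        \<le> ennreal (\<epsilon> / 2) + of_nat n * ennreal (\<epsilon> / (2 * n))"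
        by (intro add_mono mult_left_mono v_le bspec[OF g] imageI x) auto
      also have "\<dots> = ennreal \<epsilon>"
        using that \<open>n \<ge> 1\<close>
        by (simp add: ennreal_of_nat_eq_real_of_nat flip: ennreal_mult' ennreal_plus)
      finally show "(\<integral>\<^sup>+ y\<in>{y \<in> space M. f y \<ge> of_nat n * g y}. f y \<partial>M) \<le> ennreal \<epsilon>" .
    qed
  qed
  moreover have "(\<lambda>x y. G x y * q y) ` space M \<subseteq> borel_measurable M"
    by auto
  ultimately show "q \<in> F_ui M G"
    by (simp add: F_ui_def unif_integrable_def)
qed

end
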